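(* Let $A$ be a set with $|A| \ge 2$. (i) The set of subalgebras of $(\mathcal{O}_A; \zeta, \tau, \nabla, \ast)$ containing all projections is uncountable. (ii) The set of subalgebras of $(\mathcal{O}_A; \zeta, \tau, \nabla, \ast)$ is uncountable.
   Context: An operation on $A$ is a map $f\colon A^n \to A$ for some integer $n \ge 1$; $\mathcal{O}_A$ is the set of all operations on $A$. The projections are the operations $e_i^{n,A}\colon A^n\to A$, $(a_1,\dots,a_n)\mapsto a_i$, for $1\le i\le n$. For $f$ $n$-ary and $g$ $m$-ary: $(\zeta f)(x_1,\dots,x_n) := f(x_2,\dots,x_n,x_1)$ and $(\tau f)(x_1,\dots,x_n) := f(x_2,x_1,x_3,\dots,x_n)$ for $n>1$, with $\zeta f=\tau f=f$ for $n=1$; $(\nabla f)(x_1,\dots,x_{n+1}) := f(x_2,\dots,x_{n+1})$; $(f \ast g)(x_1,\dots,x_{m+n-1}) := f(g(x_1,\dots,x_m),x_{m+1},\dots,x_{m+n-1})$. Subalgebras are identified with their universes, i.e. subsets of $\mathcal{O}_A$ closed under $\zeta,\tau,\nabla,\ast$. *)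

theory Defs
  imports Main "HOL-Library.FuncSet" "HOL-Library.Countable_Set"
begin

text \<open>
  A tuple in \<open>A\<^sup>n\<close> is a list of length \<open>n\<close> over \<open>A\<close>; the coordinate \<open>x\<^sub>i\<close> is \<open>xs ! (i - 1)\<close>.
\<close>

definition tuples :: "'a set \<Rightarrow> nat \<Rightarrow> 'a list set" where
  "tuples A n = {xs. length xs = n \<and> set xs \<subseteq> A}"

text \<open>
  An operation carries its arity, since the underlying total function need not determine it.
  Outside \<open>A\<^sup>n\<close> that function is \<open>undefined\<close> (it lies in \<open>\<rightarrow>\<^sub>E\<close>), so that equality of pairs is
  equality of operations.
\<close>

type_synonym 'a operation = "nat \<times> ('a list \<Rightarrow> 'a)"

definition operations :: "'a set \<Rightarrow> 'a operation set" where
  "operations A = {(n, f). n \<ge> 1 \<and> f \<in> tuples A n \<rightarrow>\<^sub>E A}"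

definition proj :: "'a set \<Rightarrow> nat \<Rightarrow> nat \<Rightarrow> 'a operation" where
  "proj A n i = (n, \<lambda>xs\<in>tuples A n. xs ! (i - 1))"

definition projections :: "'a set \<Rightarrow> 'a operation set" where
  "projections A = {proj A n i | n i. 1 \<le> i \<and> i \<le> n}"

fun zeta :: "'a set \<Rightarrow> 'a operation \<Rightarrow> 'a operation" where
  "zeta A (n, f) = (if n > 1 then (n, \<lambda>xs\<in>tuples A n. f (tl xs @ [hd xs])) else (n, f))"

fun tau :: "'a set \<Rightarrow> 'a operation \<Rightarrow> 'a operation" where
  "tau A (n, f) =
    (if n > 1 then (n, \<lambda>xs\<in>tuples A n. f (xs ! 1 # xs ! 0 # drop 2 xs)) else (n, f))"

fun nabla :: "'a set \<Rightarrow> 'a operation \<Rightarrow> 'a operation" where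
  "nabla A (n, f) = (n + 1, \<lambda>xs\<in>tuples A (n + 1). f (tl xs))"

fun ast :: "'a set \<Rightarrow> 'a operation \<Rightarrow> 'a operation \<Rightarrow> 'a operation" where
  "ast A (n, f) (m, g) =
    (m + n - 1, \<lambda>xs\<in>tuples A (m + n - 1). f (g (take m xs) # drop m xs))"

definition subalgebra :: "'a set \<Rightarrow> 'a operation set \<Rightarrow> bool" where
  "subalgebra A S \<longleftrightarrow>
    S \<subseteq> operations A \<and>
    (\<forall>f\<in>S. zeta A f \<in> S) \<and>
    (\<forall>f\<in>S. tau A f \<in> S) \<and>
    (\<forall>f\<in>S. nabla A f \<in> S) \<and>
    (\<forall>f\<in>S. \<forall>g\<in>S. ast A f g \<in> S)"

end

theory Submission
  imports Defs
begin

text \<open>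
  Identification of variables is not among the operations \<open>\<zeta>, \<tau>, \<nabla>, \<ast>\<close>, so a composition
  can only produce terms in which every variable occurs at most once. This makes it possible to
  remember arities. Fix distinct \<open>a, b \<in> A\<close>, read as false and true, and let \<open>w\<^sub>n\<close> be the
  \<open>n\<close>-ary operation that is true iff exactly one of its arguments is true. If \<open>w\<^sub>m\<close> is
  substituted into \<open>w\<^sub>n\<close> with \<open>m, n \<ge> 2\<close>, then making two arguments of the inner operation and one
  further argument of the outer operation true gives the value true: the two inner ones cancel.
  No \<open>w\<^sub>k\<close> is true at a tuple with three true entries, so composition never creates a new \<open>w\<^sub>k\<close>.

  Rather than describing the generated subalgebras by terms, each set \<open>K\<close> of arities with
  \<open>1 \<in> K\<close> and \<open>0 \<notin> K\<close> is assigned a subalgebra in terms of values only: all operations that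
  preserve \<open>{a, b}\<close> and restrict there to ``exactly one of the arguments in \<open>V\<close> is true'' with
  \<open>|V| \<in> K\<close>, or to a function that is true at some tuple with three true entries (with two
  side conditions that make this property persist under composition). Projections are the case
  \<open>|V| = 1\<close>. The lemma \<open>admissible_compose\<close> shows closure under composition, and \<open>w\<^sub>n\<close> lies in
  the subalgebra iff \<open>n \<in> K\<close> (lemma \<open>exactly_one_op_mem_iff\<close>). Hence distinct \<open>K\<close> give distinct
  subalgebras, and there are uncountably many \<open>K\<close>.
\<close>

section \<open>Truth functions that a set of arities admits\<close>

text \<open>
  A Boolean function of the coordinates is encoded as a predicate on the set of true coordinates.
  By \<open>\<not> F {}\<close> and \<open>F {i}\<close>, the function \<open>F\<close> passes on the value of coordinate \<open>i\<close> when all other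
  coordinates are false. Therefore a true triple of a function into which \<open>F\<close> is plugged is still
  visible in the composition.
\<close>

definition true_triple :: "nat \<Rightarrow> (nat set \<Rightarrow> bool) \<Rightarrow> bool" where
  "true_triple n F \<longleftrightarrow> \<not> F {} \<and>
    (\<exists>i j k. i < n \<and> j < n \<and> k < n \<and> i \<noteq> j \<and> i \<noteq> k \<and> j \<noteq> k \<and> F {i} \<and> F {i, j, k})"

definition admissible :: "nat set \<Rightarrow> nat \<Rightarrow> (nat set \<Rightarrow> bool) \<Rightarrow> bool" where
  "admissible K n F \<longleftrightarrow>
    (\<exists>V\<subseteq>{..<n}. card V \<in> K \<and> (\<forall>X. F X \<longleftrightarrow> card (X \<inter> V) = 1)) \<or> true_triple n F"

lemma admissible_empty: "admissible K n F \<Longrightarrow> \<not> F {}"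
  by (auto simp: admissible_def true_triple_def)

lemma admissible_singleton:
  assumes "admissible K n F" "0 \<notin> K"
  obtains v where "v < n" "F {v}"
proof -
  consider V where "V \<subseteq> {..<n}" "card V \<in> K" "\<forall>X. F X \<longleftrightarrow> card (X \<inter> V) = 1"
    | "true_triple n F"
    using assms(1) by (auto simp: admissible_def)
  then show thesis
  proof cases
    case 1
    then have "V \<noteq> {}" using assms(2) by auto
    then obtain v where "v \<in> V" by blast
    then have "F {v}" using 1(3) by simp
    with \<open>v \<in> V\<close> 1(1) show thesis using that by blast
  qed (auto simp: true_triple_def intro: that)
qed

lemma true_triple_embed:
  assumes F: "true_triple n F"
    and p: "inj_on p {..<n}" "p ` {..<n} \<subseteq> {..<n'}"
    and eq: "\<And>Y. Y \<subseteq> {..<n} \<Longrightarrow> F' (p ` Y) = F Y"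
  shows "true_triple n' F'"
proof -
  obtain i j k where ijk: "i < n" "j < n" "k < n" "i \<noteq> j" "i \<noteq> k" "j \<noteq> k" "F {i}" "F {i, j, k}"
    using F by (auto simp: true_triple_def)
  have "\<not> F' {}" using eq[of "{}"] F by (simp add: true_triple_def)
  moreover have "F' {p i}" using eq[of "{i}"] ijk by simp
  moreover have "F' {p i, p j, p k}" using eq[of "{i, j, k}"] ijk by simp
  moreover have "p i \<noteq> p j" "p i \<noteq> p k" "p j \<noteq> p k"
    using ijk p(1) by (auto dest: inj_onD)
  moreover have "p i < n'" "p j < n'" "p k < n'" using ijk p(2) by auto
  ultimately show ?thesis unfolding true_triple_def by blast
qed

lemma card_Int_reindex:
  assumes "inj_on p {..<n}" "V \<subseteq> {..<n}"
  shows "card ({j. j < n \<and> p j \<in> X} \<inter> V) = card (X \<inter> p ` V)"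
proof -
  have "X \<inter> p ` V = p ` ({j. j < n \<and> p j \<in> X} \<inter> V)" using assms(2) by auto
  moreover have "inj_on p ({j. j < n \<and> p j \<in> X} \<inter> V)"
    using assms(1) by (rule inj_on_subset) auto
  ultimately show ?thesis by (simp add: card_image)
qed

lemma card_image_subset:
  assumes "inj_on p {..<n}" "V \<subseteq> {..<n}"
  shows "card (p ` V) = card V"
  using assms by (metis card_image inj_on_subset)

text \<open>
  Permuting coordinates and adding dummy ones are both instances of reading the old coordinate
  \<open>j\<close> from the new coordinate \<open>p j\<close>.
\<close>

lemma admissible_reindex:
  assumes F: "admissible K n F"
    and p: "inj_on p {..<n}" "p ` {..<n} \<subseteq> {..<n'}"
    and eq: "\<And>X. F' X = F {j. j < n \<and> p j \<in> X}"
  shows "admissible K n' F'"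
proof (cases "true_triple n F")
  case True
  have "F' (p ` Y) = F Y" if "Y \<subseteq> {..<n}" for Y
  proof -
    have "{j. j < n \<and> p j \<in> p ` Y} = Y"
      using that p(1) by (auto dest: inj_onD)
    then show ?thesis by (simp add: eq)
  qed
  then show ?thesis using true_triple_embed[OF True p] by (simp add: admissible_def)
next
  case False
  then obtain V where V: "V \<subseteq> {..<n}" "card V \<in> K" "\<forall>X. F X \<longleftrightarrow> card (X \<inter> V) = 1"
    using F by (auto simp: admissible_def)
  have "p ` V \<subseteq> {..<n'}" using V(1) p(2) by blast
  moreover have "card (p ` V) \<in> K" using V card_image_subset[OF p(1)] by simp
  moreover have "\<forall>X. F' X \<longleftrightarrow> card (X \<inter> p ` V) = 1"
    using V(3) eq card_Int_reindex[OF p(1) V(1)] by simp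
  ultimately show ?thesis unfolding admissible_def by blast
qed

text \<open>
  Here \<open>G\<close> takes the first \<open>m\<close> coordinates and its value is plugged into coordinate \<open>0\<close> of \<open>F\<close>.
  A true triple of \<open>F\<close> survives by letting a coordinate \<open>v\<close> with \<open>G {v}\<close> stand in for
  coordinate \<open>0\<close>. Now let \<open>F\<close> be of the form ``exactly one in \<open>V\<close>''. If \<open>0 \<notin> V\<close>, the composition
  ignores \<open>G\<close> and has the form of \<open>F\<close>. If \<open>0 \<in> V\<close>, a true triple of \<open>G\<close> stays one, since making the
  coordinates of \<open>F\<close> other than \<open>0\<close> false turns the composition into \<open>G\<close>. If \<open>G\<close> is ``exactly one
  in \<open>W\<close>'' as well, the composition is again of this form when \<open>V\<close> or \<open>W\<close> is a singleton;
  otherwise two coordinates in \<open>W\<close>, which cancel in \<open>G\<close>, and one in \<open>V\<close> form a true triple.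
\<close>

lemma admissible_compose:
  assumes F: "admissible K n F" and G: "admissible K m G"
    and K: "0 \<notin> K" and n: "n \<ge> 1"
    and local: "\<And>X. G X = G (X \<inter> {..<m})"
    and eq: "\<And>X. H X = F {j. j < n \<and> (if j = 0 then G X else j + (m - 1) \<in> X)}"
  shows "admissible K (m + n - 1) H"
proof -
  obtain v where v: "v < m" "G {v}" using admissible_singleton[OF G K] .
  have G0: "\<not> G {}" and F0: "\<not> F {}" using F G admissible_empty by auto
  define p where "p \<equiv> \<lambda>v j. if j = 0 then v else j + (m - 1)"
  \<comment> \<open>Injective because \<open>v \<le> m - 1 < j + (m - 1)\<close> for \<open>j \<ge> 1\<close>.\<close>
  have p: "inj_on (p v) {..<n}" "p v ` {..<n} \<subseteq> {..<m + n - 1}" if "v < m" for v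
    using that n by (auto simp: p_def inj_on_def)
  consider (trF) "true_triple n F"
    | (exF) V where "V \<subseteq> {..<n}" "card V \<in> K" "\<And>X. F X \<longleftrightarrow> card (X \<inter> V) = 1"
    using F by (auto simp: admissible_def)
  then show ?thesis
  proof cases
    case trF
    have "H (p v ` Y) = F Y" if "Y \<subseteq> {..<n}" for Y
    proof -
      have "p v ` Y \<inter> {..<m} = (if 0 \<in> Y then {v} else {})"
        using v(1) by (auto simp: p_def split: if_splits)
      then have "G (p v ` Y) \<longleftrightarrow> 0 \<in> Y" using local[of "p v ` Y"] v(2) G0 by simp
      moreover have "j + (m - 1) \<in> p v ` Y \<longleftrightarrow> j \<in> Y" if "j \<noteq> 0" for j
      proof
        assume "j + (m - 1) \<in> p v ` Y"
        then obtain y where "y \<in> Y" "j + (m - 1) = p v y" by blast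
        moreover have "y = j"
          using that v(1) \<open>j + (m - 1) = p v y\<close> unfolding p_def
          by (simp only: split: if_splits)
        ultimately show "j \<in> Y" by simp
      next
        assume "j \<in> Y"
        then show "j + (m - 1) \<in> p v ` Y"
          using that by (intro image_eqI[of _ _ j]) (simp_all add: p_def)
      qed
      ultimately have "{j. j < n \<and> (if j = 0 then G (p v ` Y) else j + (m - 1) \<in> p v ` Y)} = Y"
        using that by auto
      then show ?thesis by (simp add: eq)
    qed
    then show ?thesis using true_triple_embed[OF trF p[OF v(1)]] by (simp add: admissible_def)
  next
    case exF
    have finV: "finite V" using exF(1) finite_subset by blast
    show ?thesis
    proof (cases "0 \<in> V")
      case False
      let ?q = "\<lambda>j. j + (m - 1)"
      have q: "inj_on ?q {..<n}" by (simp add: inj_on_def)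
      have "{j. j < n \<and> (if j = 0 then G X else j + (m - 1) \<in> X)} \<inter> V
          = {j. j < n \<and> ?q j \<in> X} \<inter> V" for X
        using False by (auto split: if_splits)
      then have "\<forall>X. H X \<longleftrightarrow> card (X \<inter> ?q ` V) = 1"
        using eq exF(3) card_Int_reindex[OF q exF(1)] by simp
      moreover have "?q ` V \<subseteq> {..<m + n - 1}" using exF(1) v(1) by fastforce
      moreover have "card (?q ` V) \<in> K" using exF(2) card_image_subset[OF q exF(1)] by simp
      ultimately show ?thesis unfolding admissible_def by blast
    next
      case True
      have F_single: "F {j} \<longleftrightarrow> j \<in> V" for j using exF(3)[of "{j}"] by (simp add: Int_insert_left)
      consider (trG) "true_triple m G"
        | (exG) W where "W \<subseteq> {..<m}" "card W \<in> K" "\<And>X. G X \<longleftrightarrow> card (X \<inter> W) = 1"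
        using G by (auto simp: admissible_def)
      then show ?thesis
      proof cases
        case trG
        have "H (id ` Y) = G Y" if "Y \<subseteq> {..<m}" for Y
        proof -
          have "{j. j < n \<and> (if j = 0 then G Y else j + (m - 1) \<in> Y)} = (if G Y then {0} else {})"
            using n that v(1) by (auto split: if_splits)
          then show ?thesis using F_single[of 0] True F0 by (simp add: eq)
        qed
        then have "true_triple (m + n - 1) H"
          by (intro true_triple_embed[OF trG, of id]) (use n in auto)
        then show ?thesis by (simp add: admissible_def)
      next
        case exG
        show ?thesis
        proof (cases "card V = 1 \<or> card W = 1")
          case singleton: True
          then consider "V = {0}" | u where "W = {u}"
            using True by (metis card_1_singletonE singletonD)
          then show ?thesis
          proof cases
            case 1
            have "{j. j < n \<and> (if j = 0 then G X else j + (m - 1) \<in> X)} \<inter> V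
                = (if G X then {0} else {})" for X
              using 1 n by auto
            then have "H X = G X" for X using eq exF(3) by simp
            moreover have "W \<subseteq> {..<m + n - 1}" using exG(1) n by fastforce
            ultimately show ?thesis using exG unfolding admissible_def by auto
          next
            case 2
            have "G X \<longleftrightarrow> u \<in> X" for X using exG(3)[of X] 2 by (simp add: Int_insert_right)
            then have "H X = F {j. j < n \<and> p u j \<in> X}" for X
              unfolding eq p_def by (intro arg_cong[where f = F]) auto
            moreover have "u < m" using exG(1) 2 by simp
            ultimately show ?thesis using admissible_reindex[OF F p] by blast
          qed
        next
          case False
          have "card W \<ge> 2" "card V \<ge> 2" using False K exF(2) exG(2)
            by (metis One_nat_def less_2_cases not_le)+
          then obtain i j k where ij: "i \<in> W" "j \<in> W" "i \<noteq> j" and k: "k \<in> V" "k \<noteq> 0"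
            by (metis True card_2_iff' card_le_Suc0_iff_eq finV finite_subset[OF exG(1)]
                finite_lessThan not_less_eq_eq numeral_2_eq_2)
          let ?k = "k + (m - 1)"
          have lt: "i < m" "j < m" "k < n" using ij k exF(1) exG(1) by auto
          then have k_notin: "?k \<notin> W" using k exG(1) by fastforce
          have Gi: "G {i}" using exG(3)[of "{i}"] ij by simp
          have "{i, j, ?k} \<inter> W = {i, j}" using ij k_notin by auto
          then have Gijk: "\<not> G {i, j, ?k}" using exG(3)[of "{i, j, ?k}"] ij by simp
          have "{l. l < n \<and> (if l = 0 then G {i} else l + (m - 1) \<in> {i})} = {0}"
            using Gi n lt by (auto split: if_splits)
          then have "H {i}" using F_single True by (simp only: eq)
          moreover have "{l. l < n \<and> (if l = 0 then G {i, j, ?k} else l + (m - 1) \<in> {i, j, ?k})}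
              = {k}"
            using Gijk lt k by (auto split: if_splits)
          then have "H {i, j, ?k}" using F_single k by (simp only: eq)
          moreover have "{l. l < n \<and> (if l = 0 then G {} else l + (m - 1) \<in> {})} = {}"
            using G0 by auto
          then have "\<not> H {}" using F0 by (simp only: eq not_False_eq_True)
          moreover have "i < m + n - 1" "j < m + n - 1" "?k < m + n - 1" "i \<noteq> ?k" "j \<noteq> ?k"
            using lt k by auto
          ultimately have "true_triple (m + n - 1) H"
            using ij(3) unfolding true_triple_def by blast
          then show ?thesis by (simp add: admissible_def)
        qed
      qed
    qed
  qed
qed

section \<open>The subalgebra of a set of arities\<close>

definition bit_tuple :: "'a \<Rightarrow> 'a \<Rightarrow> nat \<Rightarrow> nat set \<Rightarrow> 'a list" where
  "bit_tuple a b n X = map (\<lambda>i. if i \<in> X then b else a) [0..<n]"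

lemma length_bit_tuple [simp]: "length (bit_tuple a b n X) = n"
  by (simp add: bit_tuple_def)

lemma nth_bit_tuple [simp]: "i < n \<Longrightarrow> bit_tuple a b n X ! i = (if i \<in> X then b else a)"
  by (simp add: bit_tuple_def)

lemma bit_tuple_in_tuples: "a \<in> A \<Longrightarrow> b \<in> A \<Longrightarrow> bit_tuple a b n X \<in> tuples A n"
  by (auto simp: tuples_def bit_tuple_def)

lemma bit_tuple_Int: "bit_tuple a b n X = bit_tuple a b n (X \<inter> {..<n})"
  by (simp add: bit_tuple_def)

definition arity_algebra :: "'a set \<Rightarrow> 'a \<Rightarrow> 'a \<Rightarrow> nat set \<Rightarrow> 'a operation set" where
  "arity_algebra A a b K = {(n, f). (n, f) \<in> operations A \<and>
    (\<forall>X. f (bit_tuple a b n X) \<in> {a, b}) \<and> admissible K n (\<lambda>X. f (bit_tuple a b n X) = b)}"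

lemma operations_closed:
  assumes "f \<in> operations A"
  shows "zeta A f \<in> operations A" "tau A f \<in> operations A" "nabla A f \<in> operations A"
    "g \<in> operations A \<Longrightarrow> ast A f g \<in> operations A"
proof -
  obtain n f' where f: "f = (n, f')" "n \<ge> 1" "f' \<in> tuples A n \<rightarrow>\<^sub>E A"
    using assms by (auto simp: operations_def)
  have opI: "(k, \<lambda>xs\<in>tuples A k. f' (t xs)) \<in> operations A"
    if "k \<ge> 1" "\<And>xs. xs \<in> tuples A k \<Longrightarrow> t xs \<in> tuples A n" for k t
    using that f(3) by (auto simp: operations_def)
  have "tl xs @ [hd xs] \<in> tuples A n" if "xs \<in> tuples A n" for xs
    using that f(2) by (cases xs) (auto simp: tuples_def)
  then show "zeta A f \<in> operations A" using f(1,2) assms opI by simp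
  have "xs ! 1 # xs ! 0 # drop 2 xs \<in> tuples A n" if "xs \<in> tuples A n" "n > 1" for xs
  proof -
    obtain x y ys where "xs = x # y # ys"
      using \<open>xs \<in> tuples A n\<close> \<open>n > 1\<close> unfolding tuples_def
      by (cases xs; cases "tl xs"; auto)
    then show ?thesis using that by (simp add: tuples_def)
  qed
  then show "tau A f \<in> operations A" using f(1,2) assms opI by simp
  have "tl xs \<in> tuples A n" if "xs \<in> tuples A (n + 1)" for xs
    using that by (cases xs) (auto simp: tuples_def)
  then show "nabla A f \<in> operations A" using f(1) opI by simp
  show "ast A f g \<in> operations A" if g_op: "g \<in> operations A"
  proof -
    obtain m g' where g: "g = (m, g')" "m \<ge> 1" "g' \<in> tuples A m \<rightarrow>\<^sub>E A"
      using g_op by (auto simp: operations_def)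
    have "g' (take m xs) # drop m xs \<in> tuples A n" if "xs \<in> tuples A (m + n - 1)" for xs
    proof -
      have "take m xs \<in> tuples A m"
        using that f(2) set_take_subset[of m xs] by (auto simp: tuples_def)
      then have "g' (take m xs) \<in> A" using g(3) by auto
      then show ?thesis
        using that f(2) set_drop_subset[of m xs] by (auto simp: tuples_def)
    qed
    then show ?thesis using f(1,2) g(1,2) opI[of "m + n - 1"] by simp
  qed
qed

text \<open>
  The three unary operations differ only in the map \<open>p\<close> that says from which new coordinate each
  old one is read.
\<close>

lemma arity_algebra_reindex:
  assumes f: "(n, f) \<in> arity_algebra A a b K"
    and op: "(n', f') \<in> operations A"
    and p: "inj_on p {..<n}" "p ` {..<n} \<subseteq> {..<n'}"
    and eq: "\<And>X. f' (bit_tuple a b n' X) = f (bit_tuple a b n {j. j < n \<and> p j \<in> X})"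
  shows "(n', f') \<in> arity_algebra A a b K"
proof -
  have "admissible K n (\<lambda>X. f (bit_tuple a b n X) = b)"
    using f by (simp add: arity_algebra_def)
  then have "admissible K n' (\<lambda>X. f' (bit_tuple a b n' X) = b)"
    by (rule admissible_reindex[OF _ p]) (simp add: eq)
  then show ?thesis using f op by (simp add: arity_algebra_def eq)
qed

lemma arity_algebra_zeta:
  assumes "a \<in> A" "b \<in> A" "(n, f) \<in> arity_algebra A a b K"
  shows "zeta A (n, f) \<in> arity_algebra A a b K"
proof (cases "n > 1")
  case True
  let ?p = "\<lambda>j. if Suc j < n then Suc j else 0"
  have op: "zeta A (n, f) \<in> operations A"
    using assms(3) by (intro operations_closed) (simp add: arity_algebra_def)
  have "tl (bit_tuple a b n X) @ [hd (bit_tuple a b n X)]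
      = bit_tuple a b n {j. j < n \<and> ?p j \<in> X}" for X
  proof (rule nth_equalityI)
    have "bit_tuple a b n X \<noteq> []" using True by (simp add: bit_tuple_def)
    then show "(tl (bit_tuple a b n X) @ [hd (bit_tuple a b n X)]) ! i
        = bit_tuple a b n {j. j < n \<and> ?p j \<in> X} ! i"
      if "i < length (tl (bit_tuple a b n X) @ [hd (bit_tuple a b n X)])" for i
      using that True by (auto simp: nth_append nth_tl hd_conv_nth)
  qed (use True in simp)
  moreover have "inj_on ?p {..<n}" "?p ` {..<n} \<subseteq> {..<n}"
    using True by (auto simp: inj_on_def split: if_splits)
  ultimately show ?thesis
    using True assms op
    by (auto simp: bit_tuple_in_tuples intro!: arity_algebra_reindex[OF assms(3), where p = ?p])
qed (use assms in simp)

lemma arity_algebra_tau: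
  assumes "a \<in> A" "b \<in> A" "(n, f) \<in> arity_algebra A a b K"
  shows "tau A (n, f) \<in> arity_algebra A a b K"
proof (cases "n > 1")
  case True
  let ?p = "\<lambda>j::nat. if j = 0 then 1 else if j = 1 then 0 else j"
  have op: "tau A (n, f) \<in> operations A"
    using assms(3) by (intro operations_closed) (simp add: arity_algebra_def)
  have "bit_tuple a b n X ! 1 # bit_tuple a b n X ! 0 # drop 2 (bit_tuple a b n X)
      = bit_tuple a b n {j. j < n \<and> ?p j \<in> X}" for X
    by (rule nth_equalityI) (use True in \<open>auto simp: nth_Cons numeral_2_eq_2 split: nat.splits\<close>)
  moreover have "inj_on ?p {..<n}" "?p ` {..<n} \<subseteq> {..<n}"
    using True by (auto simp: inj_on_def split: if_splits)
  ultimately show ?thesis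
    using True assms op
    by (auto simp: bit_tuple_in_tuples intro!: arity_algebra_reindex[OF assms(3), where p = ?p])
qed (use assms in simp)

lemma arity_algebra_nabla:
  assumes "a \<in> A" "b \<in> A" "(n, f) \<in> arity_algebra A a b K"
  shows "nabla A (n, f) \<in> arity_algebra A a b K"
proof -
  have op: "nabla A (n, f) \<in> operations A"
    using assms(3) by (intro operations_closed) (simp add: arity_algebra_def)
  have "tl (bit_tuple a b (Suc n) X) = bit_tuple a b n {j. j < n \<and> Suc j \<in> X}" for X
    by (rule nth_equalityI) (auto simp: nth_tl)
  then show ?thesis
    using assms op
    by (auto simp: bit_tuple_in_tuples intro!: arity_algebra_reindex[OF assms(3), where p = Suc])
qed

lemma arity_algebra_ast:
  assumes ab: "a \<in> A" "b \<in> A" "a \<noteq> b" and K: "0 \<notin> K"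
    and f: "(n, f) \<in> arity_algebra A a b K" and g: "(m, g) \<in> arity_algebra A a b K"
  shows "ast A (n, f) (m, g) \<in> arity_algebra A a b K"
proof -
  have n: "n \<ge> 1" and m: "m \<ge> 1"
    using f g by (auto simp: arity_algebra_def operations_def)
  define G where "G \<equiv> \<lambda>X. g (bit_tuple a b m X) = b"
  define h where "h \<equiv> \<lambda>xs\<in>tuples A (m + n - 1). f (g (take m xs) # drop m xs)"
  define Z where "Z \<equiv> \<lambda>X. {j. j < n \<and> (if j = 0 then G X else j + (m - 1) \<in> X)}"
  have op: "(m + n - 1, h) \<in> operations A"
    using f g operations_closed(4)[of "(n, f)" A "(m, g)"]
    by (auto simp: arity_algebra_def h_def)
  have g_val: "g (bit_tuple a b m X) = (if G X then b else a)" for X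
    using g by (auto simp: arity_algebra_def G_def)
  have arg: "g (take m (bit_tuple a b (m + n - 1) X)) # drop m (bit_tuple a b (m + n - 1) X)
      = bit_tuple a b n (Z X)" for X
  proof -
    have "take m (bit_tuple a b (m + n - 1) X) = bit_tuple a b m X"
      by (rule nth_equalityI) (use n in auto)
    then have "g (take m (bit_tuple a b (m + n - 1) X)) = (if G X then b else a)"
      by (simp add: g_val)
    then show ?thesis
      by (intro nth_equalityI)
        (use n m in \<open>auto simp: nth_Cons Z_def add.commute split: nat.splits\<close>)
  qed
  have h_val: "h (bit_tuple a b (m + n - 1) X) = f (bit_tuple a b n (Z X))" for X
    unfolding h_def using ab by (simp only: restrict_apply' bit_tuple_in_tuples arg)
  have "admissible K (m + n - 1) (\<lambda>X. h (bit_tuple a b (m + n - 1) X) = b)"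
  proof (rule admissible_compose[OF _ _ K n])
    show "admissible K n (\<lambda>X. f (bit_tuple a b n X) = b)"
      using f by (simp add: arity_algebra_def)
    show "admissible K m G" using g by (simp add: arity_algebra_def G_def)
    show "G X = G (X \<inter> {..<m})" for X
      unfolding G_def using bit_tuple_Int[of a b m X] by simp
  qed (simp only: h_val Z_def)
  moreover have "\<forall>X. h (bit_tuple a b (m + n - 1) X) \<in> {a, b}"
    using f by (simp only: h_val) (simp add: arity_algebra_def)
  ultimately have "(m + n - 1, h) \<in> arity_algebra A a b K"
    using op by (simp add: arity_algebra_def)
  then show ?thesis by (simp add: h_def)
qed

lemma subalgebra_arity_algebra:
  assumes "a \<in> A" "b \<in> A" "a \<noteq> b" "0 \<notin> K"
  shows "subalgebra A (arity_algebra A a b K)"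
proof -
  have "arity_algebra A a b K \<subseteq> operations A" by (auto simp: arity_algebra_def)
  then show ?thesis
    unfolding subalgebra_def
    using arity_algebra_zeta[OF assms(1,2)] arity_algebra_tau[OF assms(1,2)]
      arity_algebra_nabla[OF assms(1,2)] arity_algebra_ast[OF assms]
    by (metis prod.exhaust)
qed

lemma projections_subset_arity_algebra:
  assumes "a \<in> A" "b \<in> A" "a \<noteq> b" "1 \<in> K"
  shows "projections A \<subseteq> arity_algebra A a b K"
proof
  fix h assume "h \<in> projections A"
  then obtain n i where h: "h = proj A n i" and i: "1 \<le> i" "i \<le> n"
    by (auto simp: projections_def)
  have "proj A n i \<in> operations A"
    using i by (auto simp: proj_def operations_def tuples_def)
  moreover have val: "(\<lambda>xs\<in>tuples A n. xs ! (i - 1)) (bit_tuple a b n X)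
      = (if i - 1 \<in> X then b else a)" for X
    using assms i by (simp add: bit_tuple_in_tuples)
  moreover have "admissible K n (\<lambda>X. (if i - 1 \<in> X then b else a) = b)"
    unfolding admissible_def
    by (intro disjI1 exI[of _ "{i - 1}"]) (use assms i in auto)
  ultimately show "h \<in> arity_algebra A a b K"
    by (simp add: h proj_def arity_algebra_def del: restrict_apply)
qed

section \<open>Operations that separate the subalgebras\<close>

definition exactly_one_op :: "'a set \<Rightarrow> 'a \<Rightarrow> 'a \<Rightarrow> nat \<Rightarrow> 'a operation" where
  "exactly_one_op A a b n =
    (n, \<lambda>xs\<in>tuples A n. if card {i. i < n \<and> xs ! i = b} = 1 then b else a)"

lemma admissible_exactly_one_iff:
  "admissible K n (\<lambda>X. card (X \<inter> {..<n}) = 1) \<longleftrightarrow> n \<in> K"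
proof
  assume "n \<in> K"
  then show "admissible K n (\<lambda>X. card (X \<inter> {..<n}) = 1)"
    unfolding admissible_def by (intro disjI1 exI[of _ "{..<n}"]) simp
next
  assume "admissible K n (\<lambda>X. card (X \<inter> {..<n}) = 1)"
  then consider V where "card V \<in> K" "\<forall>X. card (X \<inter> {..<n}) = 1 \<longleftrightarrow> card (X \<inter> V) = 1"
    | "true_triple n (\<lambda>X. card (X \<inter> {..<n}) = 1)"
    by (auto simp: admissible_def)
  then show "n \<in> K"
  proof cases
    case 1
    \<comment> \<open>Singletons \<open>X\<close> recover the set of relevant coordinates.\<close>
    have "i \<in> V \<longleftrightarrow> i < n" for i using 1(2)[rule_format, of "{i}"]
      by (simp add: Int_insert_left split: if_splits)
    then have "V = {..<n}" by auto
    then show ?thesis using 1(1) by simp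
  next
    case 2
    then obtain i j k where "i < n" "j < n" "k < n" "i \<noteq> j" "i \<noteq> k" "j \<noteq> k"
      "card ({i, j, k} \<inter> {..<n}) = 1"
      by (auto simp: true_triple_def)
    then show ?thesis by simp
  qed
qed

lemma exactly_one_op_mem_iff:
  assumes "a \<in> A" "b \<in> A" "a \<noteq> b" "n \<ge> 1"
  shows "exactly_one_op A a b n \<in> arity_algebra A a b K \<longleftrightarrow> n \<in> K"
proof -
  have "{i. i < n \<and> bit_tuple a b n X ! i = b} = X \<inter> {..<n}" for X
    using assms by (auto split: if_splits)
  then have "(\<lambda>xs\<in>tuples A n. if card {i. i < n \<and> xs ! i = b} = 1 then b else a)
      (bit_tuple a b n X) = (if card (X \<inter> {..<n}) = 1 then b else a)" for X
    using assms by (simp add: bit_tuple_in_tuples)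
  moreover have "exactly_one_op A a b n \<in> operations A"
    using assms by (auto simp: exactly_one_op_def operations_def)
  moreover have "(if P then b else a) = b \<longleftrightarrow> P" for P using assms by simp
  ultimately show ?thesis
    using admissible_exactly_one_iff[of K n]
    by (simp add: exactly_one_op_def arity_algebra_def del: restrict_apply One_nat_def)
qed

lemma uncountable_UNIV_nat_set: "uncountable (UNIV :: nat set set)"
  using Cantors_theorem[of "UNIV :: nat set"] by (simp add: uncountable_def)

theorem theorem4p3:
  fixes A :: "'a set"
  assumes "infinite A \<or> card A \<ge> 2"
  shows "uncountable {S. subalgebra A S \<and> projections A \<subseteq> S} \<and>
         uncountable {S. subalgebra A S}"
proof -
  obtain a b where ab: "a \<in> A" "b \<in> A" "a \<noteq> b"
  proof -
    have "\<not> (\<exists>x. A \<subseteq> {x})"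
    proof
      assume "\<exists>x. A \<subseteq> {x}"
      then obtain x where "A \<subseteq> {x}" ..
      then show False
        using assms card_mono[of "{x}" A] finite_subset[of A "{x}"] by auto
    qed
    then show thesis using that by blast
  qed
  \<comment> \<open>The shift by 2 frees the arities 0 and 1, of which the first must be excluded and the
    second must be present.\<close>
  define S where "S I = arity_algebra A a b (insert 1 ((+) 2 ` I))" for I
  have "inj S"
  proof (rule injI)
    fix I J assume "S I = S J"
    moreover have "exactly_one_op A a b (2 + n) \<in> S I \<longleftrightarrow> n \<in> I" for n I
      unfolding S_def using exactly_one_op_mem_iff[OF ab, of "2 + n"] by auto
    ultimately show "I = J" by blast
  qed
  then have "uncountable (range S)"
    using uncountable_UNIV_nat_set countable_image_inj_on by blast
  moreover have "range S \<subseteq> {S. subalgebra A S \<and> projections A \<subseteq> S}"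
    unfolding S_def
    by (intro image_subsetI CollectI conjI subalgebra_arity_algebra[OF ab]
        projections_subset_arity_algebra[OF ab]) auto
  ultimately have "uncountable {S. subalgebra A S \<and> projections A \<subseteq> S}"
    using countable_subset by blast
  moreover have "{S. subalgebra A S \<and> projections A \<subseteq> S} \<subseteq> {S. subalgebra A S}" by blast
  ultimately show ?thesis using countable_subset by blast
qed

end
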